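(* Let $p \in \mathcal{M}_{n,d}$ with all $p_i > 1$. Then the logarithmic Voronoi cell of $p$ (with respect to the model $\mathcal{M}_{n,d}$ in $d\cdot\Delta_{n-1}$) is the dual polytope $(\log P_n(p))^*$ of the logarithmic root polytope $\log P_n(p)$.
   Context: $[n]=\{1,\dots,n\}$, $n \ge 2$. $\Delta_{n-1} = \{u \in \mathbb{R}^n : \sum u_i = 1,\ u_i > 0\}$ is the open probability simplex and $d\cdot\Delta_{n-1}$ its scaling by $d$. $\mathcal{M}_{n,d}$ is the set of all vectors of nonnegative integers $q=(q_1,\dots,q_n)$ with $\sum_i q_i = d$. For $u \in d\cdot\Delta_{n-1}$ let $\ell_u(q) = \sum_i u_i\log(q_i)$ (equal to $-\infty$ if some $q_i=0$). The logarithmic Voronoi cell of $p\in\mathcal{M}_{n,d}$ is the set of $u \in d\cdot\Delta_{n-1}$ such that $\ell_u(p) \geq \ell_u(q)$ for all $q \in \mathcal{M}_{n,d}$. For $p \in \mathcal{M}_{n,d}$ with all $p_k>1$, put $a_i := \log\left(\frac{p_i+1}{p_i}\right)$, $b_j := \log\left(\frac{p_j}{p_j-1}\right)$, and for $i\neq j$ in $[n]$ $$v_{ij} := \frac{1}{b_j p_j - a_i p_i}\left[a_i e_i - b_j e_j - \frac{a_i - b_j}{n}\mathbf{1}\right],$$ where $e_1,\dots,e_n$ is the standard basis of $\mathbb{R}^n$ and $\mathbf{1} = \sum_k e_k$; all $v_{ij}$ are orthogonal to $\mathbf{1}$. The logarithmic root polytope $\log P_n(p)$ is the convex hull of the $v_{ij}$,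 $i\neq j\in[n]$. The dual is the polar dual taken in the hyperplane $\mathbf{1}^\perp$, where the affine hyperplane $\{u:\sum_k u_k = d\}$ is identified with $\mathbf{1}^\perp$ by taking $p$ as the origin: $(\log P_n(p))^* = \{y \in \mathbf{1}^\perp : \langle v, y\rangle \leq 1 \text{ for all } v \in \log P_n(p)\}$, so the assertion is that the logarithmic Voronoi cell of $p$ equals $p + (\log P_n(p))^*$. *)

theory Defs
  imports "HOL-Analysis.Analysis"
begin

text \<open>
  The index set of size n is a finite type \<open>'n\<close>, so that n is \<open>CARD('n)\<close>. The vector of ones is
  \<open>1 :: real ^ 'n\<close> (the numeral of the pointwise ring structure), and the standard basis
  vectors are \<open>axis i 1\<close>.
\<close>

definition open_prob_simplex :: "(real ^ 'n) set" where
  "open_prob_simplex = {u. (\<Sum>i\<in>UNIV. u $ i) = 1 \<and> (\<forall>i. u $ i > 0)}"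

definition scaled_open_simplex :: "nat \<Rightarrow> (real ^ 'n) set" where
  "scaled_open_simplex d = (\<lambda>u. real d *\<^sub>R u) ` open_prob_simplex"

definition lattice_model :: "nat \<Rightarrow> (nat ^ 'n) set" where
  "lattice_model d = {q. (\<Sum>i\<in>UNIV. q $ i) = d}"

definition real_vec :: "nat ^ 'n \<Rightarrow> real ^ 'n" where
  "real_vec q = (\<chi> i. real (q $ i))"

text \<open>
  In HOL \<open>ln 0 = 0\<close>, hence the explicit case distinction. The value \<open>-\<infinity>\<close> for points
  \<open>q\<close> with a zero coordinate is the intended one because \<open>u\<close> only ranges over vectors with
  positive coordinates.
\<close>

definition log_likelihood :: "real ^ 'n \<Rightarrow> nat ^ 'n \<Rightarrow> ereal" where
  "log_likelihood u q =
     (if \<exists>i. q $ i = 0 then -\<infinity> else ereal (\<Sum>i\<in>UNIV. u $ i * ln (real (q $ i))))"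

definition log_voronoi_cell :: "nat \<Rightarrow> nat ^ 'n \<Rightarrow> (real ^ 'n) set" where
  "log_voronoi_cell d p =
     {u \<in> scaled_open_simplex d. \<forall>q \<in> lattice_model d. log_likelihood u p \<ge> log_likelihood u q}"

definition root_a :: "nat ^ 'n \<Rightarrow> 'n \<Rightarrow> real" where
  "root_a p i = ln ((real (p $ i) + 1) / real (p $ i))"

definition root_b :: "nat ^ 'n \<Rightarrow> 'n \<Rightarrow> real" where
  "root_b p j = ln (real (p $ j) / (real (p $ j) - 1))"

definition log_root :: "nat ^ 'n \<Rightarrow> 'n \<Rightarrow> 'n \<Rightarrow> real ^ 'n" where
  "log_root p i j =
     (1 / (root_b p j * real (p $ j) - root_a p i * real (p $ i))) *\<^sub>R
       (root_a p i *\<^sub>R axis i 1 - root_b p j *\<^sub>R axis j 1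
         - ((root_a p i - root_b p j) / real CARD('n)) *\<^sub>R 1)"

definition log_root_polytope :: "nat ^ 'n \<Rightarrow> (real ^ 'n) set" where
  "log_root_polytope p = convex hull {log_root p i j | i j. i \<noteq> j}"

text \<open>The polar is taken inside the hyperplane orthogonal to the vector of ones.\<close>

definition polar_dual :: "(real ^ 'n) set \<Rightarrow> (real ^ 'n) set" where
  "polar_dual P = {y \<in> {1}\<^sup>\<bottom>. \<forall>v\<in>P. v \<bullet> y \<le> 1}"

end

theory Submission
  imports Defs
begin

text \<open>
  Both sets are cut out of the hyperplane \<open>\<Sum>i. u $ i = d\<close> by the same finite system of exchange
  inequalities \<open>a\<^sub>i u\<^sub>i \<le> b\<^sub>j u\<^sub>j\<close> for \<open>i \<noteq> j\<close>, where \<open>a\<^sub>i = root_a p i\<close> and \<open>b\<^sub>j = root_b p j\<close>. On the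
  dual side, a linear inequality need only be tested on the generators of a convex hull, and
  clearing the positive denominator of \<open>log_root p i j\<close> turns its inequality into this one
  (\<open>log_root_inner_le_1_iff\<close>). On the Voronoi side, the inequality says that the likelihood at
  \<open>p\<close> is at least that at the neighbour obtained by moving one unit from coordinate \<open>j\<close> to
  coordinate \<open>i\<close> (\<open>log_likelihood_unit_move_le_iff\<close>).

  Two things remain, both consequences of the exchange inequalities. The coordinates of \<open>u\<close> are
  positive, because one nonpositive coordinate would make all the others nonpositive, while
  their sum is \<open>d > 0\<close>. And local optimality is global optimality, because the objective is
  separable and concave: since also \<open>a\<^sub>i u\<^sub>i \<le> b\<^sub>i u\<^sub>i\<close> (as \<open>a\<^sub>i < b\<^sub>i\<close> and \<open>u\<^sub>i > 0\<close>), there is one number \<open>c\<close> that separates all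
  the forward slopes \<open>a\<^sub>i u\<^sub>i\<close> from all the backward slopes \<open>b\<^sub>j u\<^sub>j\<close>. It is a Lagrange multiplier
  for the constraint on the coordinate sum: each coordinate of the log-likelihood changes by at
  most \<open>c\<close> times the change of that coordinate, and these changes sum to zero.
\<close>

section \<open>The forward and backward slopes of the logarithm\<close>

lemma root_a_pos: "p $ i > 0 \<Longrightarrow> root_a p i > 0"
  by (simp add: root_a_def)

lemma root_b_pos: "p $ i > 1 \<Longrightarrow> root_b p i > 0"
  by (simp add: root_b_def)

lemma ln_less_minus_one: "x > 0 \<Longrightarrow> x \<noteq> 1 \<Longrightarrow> ln x < x - (1::real)"
  using ln_le_minus_one[of x] ln_eq_minus_one[of x] by fastforce

lemma root_a_mult_less_1:
  assumes "p $ i > 0"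
  shows "root_a p i * real (p $ i) < 1"
proof -
  have "root_a p i < (real (p $ i) + 1) / real (p $ i) - 1"
    unfolding root_a_def using assms by (intro ln_less_minus_one) auto
  also have "\<dots> = 1 / real (p $ i)"
    using assms by (simp add: field_simps)
  finally show ?thesis using assms by (simp add: field_simps)
qed

lemma root_b_eq_minus_ln:
  assumes "p $ i > 1"
  shows "root_b p i = - ln (1 - 1 / real (p $ i))"
proof -
  have "real (p $ i) / (real (p $ i) - 1) = inverse (1 - 1 / real (p $ i))"
    using assms by (simp add: field_simps)
  then show ?thesis using assms by (simp add: root_b_def ln_inverse)
qed

lemma root_b_mult_greater_1:
  assumes "p $ i > 1"
  shows "root_b p i * real (p $ i) > 1"
proof -
  have "ln (1 - 1 / real (p $ i)) < (1 - 1 / real (p $ i)) - 1"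
    using assms by (intro ln_less_minus_one) auto
  then have "1 / real (p $ i) < root_b p i"
    using assms by (simp add: root_b_eq_minus_ln)
  then show ?thesis using assms by (simp add: field_simps)
qed

lemma root_a_less_root_b:
  assumes "p $ i > 1"
  shows "root_a p i < root_b p i"
proof -
  have "root_a p i * real (p $ i) < root_b p i * real (p $ i)"
    using root_a_mult_less_1[of p i] root_b_mult_greater_1[of p i] assms by linarith
  then show ?thesis using assms by simp
qed

text \<open>
  By concavity no unit step away from \<open>x\<close> changes the logarithm more favourably than the first
  one. For \<open>k\<close> steps up this is the logarithm of Bernoulli's inequality
  \<open>1 + k/x \<le> (1 + 1/x)\<^sup>k\<close>; for \<open>k\<close> steps down, of the same inequality with \<open>-1/x\<close>.
\<close>

lemma ln_diff_le_forward_slope: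
  fixes x y :: nat
  assumes "0 < x" "x \<le> y"
  shows "ln (real y) - ln (real x) \<le> (real y - real x) * ln ((real x + 1) / real x)"
proof -
  let ?k = "y - x"
  have "real y / real x = 1 + real ?k * (1 / real x)"
    using assms by (simp add: field_simps of_nat_diff)
  also have "\<dots> \<le> (1 + 1 / real x) ^ ?k"
  proof (rule Bernoulli_inequality)
    show "- 1 \<le> 1 / real x" by (rule order_trans[of _ 0]) auto
  qed
  also have "1 + 1 / real x = (real x + 1) / real x"
    using assms by (simp add: field_simps)
  finally have "ln (real y / real x) \<le> ln (((real x + 1) / real x) ^ ?k)"
    using assms by (subst ln_le_cancel_iff) auto
  then show ?thesis
    using assms by (simp add: ln_div ln_realpow of_nat_diff)
qed

lemma ln_diff_le_backward_slope:
  fixes x y :: nat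
  assumes "0 < y" "y \<le> x" "1 < x"
  shows "ln (real y) - ln (real x) \<le> (real x - real y) * ln (1 - 1 / real x)"
proof -
  let ?k = "x - y"
  have "real y / real x = 1 + real ?k * (- 1 / real x)"
    using assms by (simp add: field_simps of_nat_diff)
  also have "\<dots> \<le> (1 + (- 1 / real x)) ^ ?k"
    using assms by (intro Bernoulli_inequality) (simp add: field_simps)
  finally have "ln (real y / real x) \<le> ln ((1 - 1 / real x) ^ ?k)"
    using assms by (subst ln_le_cancel_iff) auto
  then show ?thesis
    using assms by (simp add: ln_div ln_realpow of_nat_diff)
qed

text \<open>
  A number between the forward and the backward slope of \<open>t \<mapsto> u ln t\<close> at \<open>p $ i\<close> is a
  supergradient there, with respect to integer points.
\<close>

lemma weighted_ln_diff_le: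
  assumes "p $ i > 1" "q $ i > 0" "u \<ge> 0"
    and "root_a p i * u \<le> c" "c \<le> root_b p i * u"
  shows "u * (ln (real (q $ i)) - ln (real (p $ i))) \<le> c * (real (q $ i) - real (p $ i))"
proof (cases "p $ i \<le> q $ i")
  case True
  have "ln (real (q $ i)) - ln (real (p $ i)) \<le> (real (q $ i) - real (p $ i)) * root_a p i"
    using ln_diff_le_forward_slope[OF _ True] assms(1) by (simp add: root_a_def)
  then have "u * (ln (real (q $ i)) - ln (real (p $ i)))
      \<le> u * ((real (q $ i) - real (p $ i)) * root_a p i)"
    using assms(3) by (rule mult_left_mono)
  also have "\<dots> = (root_a p i * u) * (real (q $ i) - real (p $ i))"
    by simp
  also have "\<dots> \<le> c * (real (q $ i) - real (p $ i))"
    using assms(4) True by (intro mult_right_mono) auto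
  finally show ?thesis .
next
  case False
  have "ln (real (q $ i)) - ln (real (p $ i)) \<le> (real (q $ i) - real (p $ i)) * root_b p i"
    using ln_diff_le_backward_slope[of "q $ i" "p $ i"] False assms(1,2)
    by (simp add: root_b_eq_minus_ln algebra_simps)
  then have "u * (ln (real (q $ i)) - ln (real (p $ i)))
      \<le> u * ((real (q $ i) - real (p $ i)) * root_b p i)"
    using assms(3) by (rule mult_left_mono)
  also have "\<dots> = (root_b p i * u) * (real (q $ i) - real (p $ i))"
    by simp
  also have "\<dots> \<le> c * (real (q $ i) - real (p $ i))"
    using assms(5) False by (intro mult_right_mono_neg) auto
  finally show ?thesis .
qed

section \<open>The inequalities defining the dual polytope\<close>

text \<open>
  The part of \<open>log_root p i j\<close> along the vector of ones does not contribute on its orthogonal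
  hyperplane. The denominator is positive because \<open>x ln (1 + 1/x) < 1 < y ln (y / (y - 1))\<close>.
\<close>

lemma log_root_inner_le_1_iff:
  fixes p :: "nat ^ 'n"
  assumes "p $ i > 0" "p $ j > 1" "y \<bullet> 1 = 0"
  shows "log_root p i j \<bullet> y \<le> 1 \<longleftrightarrow>
    root_a p i * (real_vec p + y) $ i \<le> root_b p j * (real_vec p + y) $ j"
proof -
  let ?D = "root_b p j * real (p $ j) - root_a p i * real (p $ i)"
  have D: "?D > 0"
    using root_a_mult_less_1[of p i] root_b_mult_greater_1[of p j] assms by linarith
  have "1 \<bullet> y = 0" using assms(3) by (simp add: inner_commute)
  then have "log_root p i j \<bullet> y = (root_a p i * y $ i - root_b p j * y $ j) / ?D"
    by (simp add: log_root_def inner_diff_left inner_axis')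
  then have "log_root p i j \<bullet> y \<le> 1 \<longleftrightarrow> root_a p i * y $ i - root_b p j * y $ j \<le> ?D"
    using D by (simp only: pos_divide_le_eq mult_1)
  then show ?thesis
    by (simp add: real_vec_def distrib_left) linarith
qed

lemma convex_hull_inner_le_iff:
  fixes S :: "'a::real_inner set"
  shows "(\<forall>v\<in>convex hull S. v \<bullet> y \<le> c) \<longleftrightarrow> (\<forall>v\<in>S. v \<bullet> y \<le> c)"
proof
  assume "\<forall>v\<in>S. v \<bullet> y \<le> c"
  then have "S \<subseteq> {v. y \<bullet> v \<le> c}" by (auto simp: inner_commute)
  then have "convex hull S \<subseteq> {v. y \<bullet> v \<le> c}"
    by (rule hull_minimal) (rule convex_halfspace_le)
  then show "\<forall>v\<in>convex hull S. v \<bullet> y \<le> c" by (auto simp: inner_commute)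
qed (auto simp: hull_inc)

lemma mem_translated_polar_dual_iff:
  fixes p :: "nat ^ 'n"
  assumes "p \<in> lattice_model d" "\<forall>i. p $ i > 1"
  shows "u \<in> (\<lambda>y. real_vec p + y) ` polar_dual (log_root_polytope p) \<longleftrightarrow>
    (\<Sum>i\<in>UNIV. u $ i) = real d \<and> (\<forall>i j. i \<noteq> j \<longrightarrow> root_a p i * u $ i \<le> root_b p j * u $ j)"
proof -
  define y where "y = u - real_vec p"
  have u: "u = real_vec p + y" by (simp add: y_def)
  have "(\<Sum>i\<in>UNIV. real (p $ i)) = real d"
    using assms(1) by (simp add: lattice_model_def flip: of_nat_sum)
  then have sum_y: "y \<bullet> 1 = 0 \<longleftrightarrow> (\<Sum>i\<in>UNIV. u $ i) = real d"
    by (simp add: inner_vec_def y_def real_vec_def sum_subtractf)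
  have "u \<in> (\<lambda>y. real_vec p + y) ` polar_dual (log_root_polytope p) \<longleftrightarrow>
      y \<in> polar_dual (log_root_polytope p)"
    unfolding u by (auto simp: image_iff)
  also have "\<dots> \<longleftrightarrow> y \<bullet> 1 = 0 \<and> (\<forall>i j. i \<noteq> j \<longrightarrow> log_root p i j \<bullet> y \<le> 1)"
    unfolding polar_dual_def log_root_polytope_def convex_hull_inner_le_iff
    by (auto simp: orthogonal_comp_def orthogonal_def inner_commute[of 1 y])
  also have "\<dots> \<longleftrightarrow> y \<bullet> 1 = 0 \<and>
      (\<forall>i j. i \<noteq> j \<longrightarrow> root_a p i * u $ i \<le> root_b p j * u $ j)"
    unfolding u using assms(2) log_root_inner_le_1_iff[of p _ _ y]
    by (metis less_trans zero_less_one)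
  finally show ?thesis unfolding sum_y .
qed

section \<open>Optimality of the likelihood over the lattice points\<close>

lemma mem_scaled_open_simplex_iff:
  assumes "d > 0"
  shows "u \<in> scaled_open_simplex d \<longleftrightarrow> (\<Sum>i\<in>UNIV. u $ i) = real d \<and> (\<forall>i. u $ i > 0)"
proof
  assume "u \<in> scaled_open_simplex d"
  then show "(\<Sum>i\<in>UNIV. u $ i) = real d \<and> (\<forall>i. u $ i > 0)"
    using assms
    by (auto simp: scaled_open_simplex_def open_prob_simplex_def simp flip: sum_distrib_left)
next
  assume u: "(\<Sum>i\<in>UNIV. u $ i) = real d \<and> (\<forall>i. u $ i > 0)"
  have "u = real d *\<^sub>R ((1 / real d) *\<^sub>R u)" using assms by simp
  moreover have "(1 / real d) *\<^sub>R u \<in> open_prob_simplex"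
    using assms u by (auto simp: open_prob_simplex_def simp flip: sum_divide_distrib)
  ultimately show "u \<in> scaled_open_simplex d"
    unfolding scaled_open_simplex_def by blast
qed

definition unit_move :: "nat ^ 'n \<Rightarrow> 'n \<Rightarrow> 'n \<Rightarrow> nat ^ 'n" where
  "unit_move p i j = (\<chi> k. if k = i then p $ k + 1 else if k = j then p $ k - 1 else p $ k)"

lemma sum_UNIV_split_two:
  fixes f :: "'n::finite \<Rightarrow> 'a::comm_monoid_add"
  assumes "i \<noteq> j"
  shows "(\<Sum>k\<in>UNIV. f k) = f i + (f j + (\<Sum>k\<in>UNIV - {i, j}. f k))"
proof -
  have "(\<Sum>k\<in>UNIV. f k) = f i + (\<Sum>k\<in>UNIV - {i}. f k)"
    by (rule sum.remove) auto
  also have "(\<Sum>k\<in>UNIV - {i}. f k) = f j + (\<Sum>k\<in>UNIV - {i} - {j}. f k)"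
    using assms by (intro sum.remove) auto
  also have "UNIV - {i} - {j} = UNIV - {i, j}" by auto
  finally show ?thesis .
qed

lemma unit_move_in_lattice_model:
  assumes "i \<noteq> j" "p $ j > 0" "p \<in> lattice_model d"
  shows "unit_move p i j \<in> lattice_model d"
  using assms by (simp add: lattice_model_def unit_move_def sum_UNIV_split_two[OF assms(1)])

lemma log_likelihood_unit_move_le_iff:
  fixes p :: "nat ^ 'n"
  assumes "i \<noteq> j" "\<forall>k. p $ k > 1"
  shows "log_likelihood u (unit_move p i j) \<le> log_likelihood u p \<longleftrightarrow>
    root_a p i * u $ i \<le> root_b p j * u $ j"
proof -
  have p: "p $ k > 0" "p $ k > 1" for k
    using assms(2)[rule_format, of k] by auto
  have nonzero: "\<nexists>k. p $ k = 0" "\<nexists>k. unit_move p i j $ k = 0"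
    using p by (auto simp: unit_move_def not_le split: if_splits)
  have a: "root_a p i = ln (real (p $ i) + 1) - ln (real (p $ i))"
    using p[of i] by (simp add: root_a_def ln_div)
  have b: "root_b p j = ln (real (p $ j)) - ln (real (p $ j - 1))"
    using p[of j] by (simp add: root_b_def ln_div of_nat_diff)
  have "(\<Sum>k\<in>UNIV. u $ k * ln (real (unit_move p i j $ k)))
        \<le> (\<Sum>k\<in>UNIV. u $ k * ln (real (p $ k)))
    \<longleftrightarrow> u $ i * ln (real (p $ i) + 1) + u $ j * ln (real (p $ j - 1))
        \<le> u $ i * ln (real (p $ i)) + u $ j * ln (real (p $ j))"
    using assms(1) by (simp add: sum_UNIV_split_two[OF assms(1)] unit_move_def add.commute)
  then have "(\<Sum>k\<in>UNIV. u $ k * ln (real (unit_move p i j $ k)))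
        \<le> (\<Sum>k\<in>UNIV. u $ k * ln (real (p $ k)))
    \<longleftrightarrow> root_a p i * u $ i \<le> root_b p j * u $ j"
    unfolding a b left_diff_distrib by (simp only: mult.commute[of "u $ _"]) linarith
  then show ?thesis
    using nonzero by (simp only: log_likelihood_def if_False ereal_less_eq)
qed

text \<open>
  If \<open>u\<^sub>j \<le> 0\<close>, the exchange inequalities force every other coordinate to be nonpositive too.
\<close>

lemma exchange_imp_coord_pos:
  fixes p :: "nat ^ 'n"
  assumes "\<forall>i. p $ i > 1" "(\<Sum>i\<in>UNIV. u $ i) > 0"
    and ex: "\<And>i j. i \<noteq> j \<Longrightarrow> root_a p i * u $ i \<le> root_b p j * u $ j"
  shows "u $ j > 0"
proof (rule ccontr)
  assume neg: "\<not> u $ j > 0"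
  have "u $ i \<le> 0" for i
  proof (cases "i = j")
    case False
    have "root_b p j > 0" "root_a p i > 0"
      using assms(1) by (auto intro!: root_b_pos root_a_pos intro: less_trans[OF zero_less_one])
    moreover have "root_b p j * u $ j \<le> 0"
      using \<open>root_b p j > 0\<close> neg by (intro mult_nonneg_nonpos) auto
    ultimately show ?thesis
      using ex[OF False] by (smt (verit) mult_pos_pos)
  qed (use neg in auto)
  then have "(\<Sum>i\<in>UNIV. u $ i) \<le> 0" by (intro sum_nonpos) auto
  then show False using assms(2) by simp
qed

text \<open>
  Comparing with the one-unit moves suffices: the exchange inequalities provide a common
  Lagrange multiplier \<open>c\<close> for all coordinates.
\<close>

lemma exchange_imp_log_likelihood_le:
  fixes p :: "nat ^ 'n"
  assumes p: "\<forall>i. p $ i > 1" "p \<in> lattice_model d" and q: "q \<in> lattice_model d"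
    and u: "\<And>i. u $ i > 0"
    and ex: "\<And>i j. i \<noteq> j \<Longrightarrow> root_a p i * u $ i \<le> root_b p j * u $ j"
  shows "log_likelihood u q \<le> log_likelihood u p"
proof (cases "\<exists>i. q $ i = 0")
  case True
  then show ?thesis by (simp add: log_likelihood_def)
next
  case False
  \<comment> \<open>Any number between the largest forward and the smallest backward slope would do.\<close>
  define c where "c = Max (range (\<lambda>i. root_a p i * u $ i))"
  have lower: "root_a p i * u $ i \<le> c" for i
    unfolding c_def by (intro Max_ge) auto
  have "c \<in> range (\<lambda>i. root_a p i * u $ i)"
    unfolding c_def by (intro Max_in) auto
  then obtain m where m: "c = root_a p m * u $ m" by auto
  have upper: "c \<le> root_b p i * u $ i" for i
  proof (cases "m = i")
    case True
    have "root_a p i \<le> root_b p i"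
      using p(1) root_a_less_root_b less_imp_le by blast
    then show ?thesis unfolding m True using u[of i] by (intro mult_right_mono) auto
  qed (simp add: m ex)
  have "(\<Sum>i\<in>UNIV. u $ i * (ln (real (q $ i)) - ln (real (p $ i))))
      \<le> (\<Sum>i\<in>UNIV. c * (real (q $ i) - real (p $ i)))"
  proof (rule sum_mono)
    fix i
    have "q $ i > 0" using False by simp
    then show "u $ i * (ln (real (q $ i)) - ln (real (p $ i)))
        \<le> c * (real (q $ i) - real (p $ i))"
      using p(1) less_imp_le[OF u] lower upper by (blast intro: weighted_ln_diff_le)
  qed
  also have "\<dots> = c * (real (\<Sum>i\<in>UNIV. q $ i) - real (\<Sum>i\<in>UNIV. p $ i))"
    by (simp add: sum_subtractf flip: sum_distrib_left)
  also have "\<dots> = 0"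
    using p(2) q by (simp add: lattice_model_def del: of_nat_sum)
  finally have "(\<Sum>i\<in>UNIV. u $ i * ln (real (q $ i))) \<le> (\<Sum>i\<in>UNIV. u $ i * ln (real (p $ i)))"
    by (simp add: right_diff_distrib sum_subtractf)
  moreover have "\<nexists>i. p $ i = 0" using p(1) by (metis not_less_zero)
  ultimately show ?thesis using False by (simp add: log_likelihood_def)
qed

lemma mem_log_voronoi_cell_iff:
  fixes p :: "nat ^ 'n"
  assumes "p \<in> lattice_model d" "\<forall>i. p $ i > 1"
  shows "u \<in> log_voronoi_cell d p \<longleftrightarrow>
    (\<Sum>i\<in>UNIV. u $ i) = real d \<and> (\<forall>i j. i \<noteq> j \<longrightarrow> root_a p i * u $ i \<le> root_b p j * u $ j)"
    (is "_ \<longleftrightarrow> ?sum \<and> ?exchange")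
proof -
  have pos: "p $ i > 0" for i
    using assms(2) less_trans zero_less_one by blast
  then have "(\<Sum>i\<in>UNIV. p $ i) > 0" by (intro sum_pos) auto
  then have d: "d > 0" using assms(1) by (simp add: lattice_model_def)
  show ?thesis
  proof
    assume u: "u \<in> log_voronoi_cell d p"
    then have "?sum"
      using mem_scaled_open_simplex_iff[OF d] by (auto simp: log_voronoi_cell_def)
    moreover have "?exchange"
    proof (intro allI impI)
      fix i j :: 'n
      assume "i \<noteq> j"
      then have "log_likelihood u (unit_move p i j) \<le> log_likelihood u p"
        using u unit_move_in_lattice_model[OF _ pos assms(1)]
        unfolding log_voronoi_cell_def by blast
      then show "root_a p i * u $ i \<le> root_b p j * u $ j"
        using log_likelihood_unit_move_le_iff[OF \<open>i \<noteq> j\<close> assms(2)] by blast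
    qed
    ultimately show "?sum \<and> ?exchange" ..
  next
    assume h: "?sum \<and> ?exchange"
    then have ex: "\<And>i j. i \<noteq> j \<Longrightarrow> root_a p i * u $ i \<le> root_b p j * u $ j"
      by blast
    have "(\<Sum>i\<in>UNIV. u $ i) > 0" using h d by simp
    then have u_pos: "u $ i > 0" for i
      using exchange_imp_coord_pos[OF assms(2)] ex by blast
    then have "u \<in> scaled_open_simplex d"
      using h mem_scaled_open_simplex_iff[OF d] by blast
    moreover have "log_likelihood u q \<le> log_likelihood u p" if "q \<in> lattice_model d" for q
      using assms(2,1) that u_pos ex by (rule exchange_imp_log_likelihood_le)
    ultimately show "u \<in> log_voronoi_cell d p"
      unfolding log_voronoi_cell_def by blast
  qed
qed

theorem theorem20:
  fixes p :: "nat ^ 'n" and d :: nat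
  assumes "CARD('n) \<ge> 2"
    and "p \<in> lattice_model d"
    and "\<forall>i. p $ i > 1"
  shows "log_voronoi_cell d p = (\<lambda>y. real_vec p + y) ` polar_dual (log_root_polytope p)"
  by (rule set_eqI)
     (simp only: mem_log_voronoi_cell_iff[OF assms(2,3)]
        mem_translated_polar_dual_iff[OF assms(2,3)])

end
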